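(* For all integers $n\geq 1$ and all $y\in\mathbb{C}$, $$L_{n-1}^{(1)}(y)-F_{2n}=-\sum_{k=1}^{n-1}\left(\frac{y}{k}+1\right)L_{k-1}^{(1)}(y)\,F_{2(n-k)}.$$
   Context: $F_n$ denotes the Fibonacci numbers with $F_0=0$, $F_1=1$, $F_2=1$, $F_3=2$, $F_4=3$. $L_m^{(1)}$ denotes the $m$th $1$-associated Laguerre polynomial, $L_m^{(1)}(z)=\sum_{k=0}^{m}\binom{m+1}{m-k}\frac{(-z)^k}{k!}$. An empty sum is $0$. *)

theory Defs
  imports Complex_Main "HOL-Number_Theory.Fib"
begin

definition laguerre1 :: "nat \<Rightarrow> complex \<Rightarrow> complex" where
  "laguerre1 m z = (\<Sum>k=0..m. of_nat ((m + 1) choose (m - k)) * ((- z) ^ k / fact k))"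

end

(* Put g k = L_(k-1)^(1)(y) with g 0 = 0. The three-term Laguerre recurrence reads
   g (k+1) - 2 g k + g (k-1) = -(y/k) g k, so the factor (y/k + 1) g k of the summand equals
   3 g k - g (k+1) - g (k-1). Since F_(2j+4) = 3 F_(2j+2) - F_(2j) is the same kind of
   recurrence, the convolution telescopes. *)
theory Submission
  imports Defs
begin

(* The summation range is left free so that consecutive polynomials can be compared termwise. *)
lemma laguerre1_eq_sum:
  assumes "m \<le> N"
  shows "laguerre1 m z = (\<Sum>k\<le>N. of_nat (Suc m choose Suc k) * ((- z) ^ k / fact k))"
proof -
  have "laguerre1 m z = (\<Sum>k\<le>m. of_nat (Suc m choose Suc k) * ((- z) ^ k / fact k))"
    unfolding laguerre1_def atMost_atLeast0
  proof (rule sum.cong[OF refl])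
    fix k assume "k \<in> {0..m}"
    then have "(m + 1) choose (m - k) = Suc m choose Suc k"
      using binomial_symmetric[of "Suc k" "Suc m"] by simp
    then show "of_nat ((m + 1) choose (m - k)) * ((- z) ^ k / fact k) =
        of_nat (Suc m choose Suc k) * ((- z) ^ k / fact k)" by simp
  qed
  also have "\<dots> = (\<Sum>k\<le>N. of_nat (Suc m choose Suc k) * ((- z) ^ k / fact k))"
    using assms by (intro sum.mono_neutral_left) (auto simp: binomial_eq_0)
  finally show ?thesis .
qed

text \<open>Compare coefficients of \<open>(- z) ^ k / fact k\<close>: Pascal's rule applied twice
  collapses the second difference of the binomials, and absorption turns the result back into the
  coefficients of \<open>laguerre1 (Suc m)\<close>.\<close>

lemma laguerre1_recurrence:
  "laguerre1 (Suc (Suc m)) z - 2 * laguerre1 (Suc m) z + laguerre1 m z =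
    - (z / of_nat (m + 2)) * laguerre1 (Suc m) z"
proof -
  define t where "t k = (- z) ^ k / fact k" for k
  have "laguerre1 (Suc (Suc m)) z - 2 * laguerre1 (Suc m) z + laguerre1 m z =
      (\<Sum>k\<le>Suc (Suc m). (of_nat (Suc (Suc (Suc m)) choose Suc k)
        - 2 * of_nat (Suc (Suc m) choose Suc k) + of_nat (Suc m choose Suc k)) * t k)"
    by (simp only: laguerre1_eq_sum[of _ "Suc (Suc m)"] le_SucI order_refl t_def
        sum_distrib_left sum.distrib sum_subtractf ring_distribs left_diff_distrib mult.assoc)
  \<comment> \<open>The term \<open>k = 0\<close> drops out, as (m+3) - 2(m+2) + (m+1) = 0.\<close>
  also have "\<dots> = (\<Sum>k\<le>Suc m. of_nat (Suc m choose k) * t (Suc k))"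
    by (subst sum.atMost_Suc_shift) (simp add: algebra_simps)
  also have "\<dots> = (\<Sum>k\<le>Suc m. - (z / of_nat (m + 2)) * (of_nat (Suc (Suc m) choose Suc k) * t k))"
  proof (rule sum.cong[OF refl])
    fix k
    have "(of_nat (Suc k * (Suc (Suc m) choose Suc k)) :: complex) =
        of_nat (Suc (Suc m) * (Suc m choose k))"
      by (simp only: Suc_times_binomial_eq mult.commute)
    \<comment> \<open>The factor \<open>Suc k\<close> produced here cancels against the factorial in
      \<open>t (Suc k)\<close>.\<close>
    then have absorb: "(of_nat (Suc m choose k) :: complex) =
        of_nat (Suc k) * of_nat (Suc (Suc m) choose Suc k) / of_nat (m + 2)"
      by (simp only: of_nat_mult add_2_eq_Suc') (simp add: eq_divide_eq mult.commute del: of_nat_Suc binomial_Suc_Suc)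
    have t_Suc: "of_nat (Suc k) * t (Suc k) = - z * t k"
      by (simp add: t_def field_simps del: of_nat_Suc)
    have "of_nat (Suc m choose k) * t (Suc k) =
        (of_nat (Suc k) * t (Suc k)) * of_nat (Suc (Suc m) choose Suc k) / of_nat (m + 2)"
      unfolding absorb by (simp only: times_divide_eq_left times_divide_eq_right mult_ac)
    also have "\<dots> = - (z / of_nat (m + 2)) * (of_nat (Suc (Suc m) choose Suc k) * t k)"
      unfolding t_Suc by (simp del: binomial_Suc_Suc of_nat_add)
    finally show "of_nat (Suc m choose k) * t (Suc k) =
        - (z / of_nat (m + 2)) * (of_nat (Suc (Suc m) choose Suc k) * t k)" .
  qed
  also have "\<dots> = - (z / of_nat (m + 2)) * laguerre1 (Suc m) z"
    by (simp only: laguerre1_eq_sum[OF order_refl] t_def sum_distrib_left)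
  finally show ?thesis .
qed

lemma fib_even_recurrence: "fib (2 * Suc (Suc j)) + fib (2 * j) = 3 * fib (2 * Suc j)"
  by simp

text \<open>The boundary terms are values of the discrete Wronskian of \<open>g\<close> and the
  even-indexed Fibonacci numbers; each summand is its drop from one index to the next. The upper
  limit \<open>m\<close> is separate from \<open>n\<close> so that induction can keep the Fibonacci
  indices fixed.\<close>

lemma sum_second_difference_mult_fib:
  fixes g :: "nat \<Rightarrow> 'a::comm_ring_1"
  assumes "m \<le> n"
  shows "(\<Sum>k=1..m. (3 * g k - g (Suc k) - g (k - 1)) * of_nat (fib (2 * (Suc n - k)))) =
    g 1 * of_nat (fib (2 * Suc n)) - g 0 * of_nat (fib (2 * n))
    - (g (Suc m) * of_nat (fib (2 * (Suc n - m))) - g m * of_nat (fib (2 * (n - m))))"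
  using assms
proof (induction m)
  case 0
  then show ?case by simp
next
  case (Suc m)
  then obtain d where n: "n = Suc m + d"
    using le_Suc_ex by blast
  have "(of_nat (fib (2 * Suc (Suc d)) + fib (2 * d)) :: 'a) = of_nat (3 * fib (2 * Suc d))"
    by (simp only: fib_even_recurrence)
  then have f: "(of_nat (fib (2 * Suc (Suc d))) :: 'a) =
      3 * of_nat (fib (2 * Suc d)) - of_nat (fib (2 * d))"
    by (simp only: of_nat_add of_nat_mult of_nat_numeral eq_diff_eq)
  have idx: "Suc n - m = Suc (Suc d)" "n - m = Suc d" "Suc n - Suc m = Suc d" "n - Suc m = d"
    using n by auto
  have "(\<Sum>k=1..Suc m. (3 * g k - g (Suc k) - g (k - 1)) * of_nat (fib (2 * (Suc n - k)))) =
      (\<Sum>k=1..m. (3 * g k - g (Suc k) - g (k - 1)) * of_nat (fib (2 * (Suc n - k))))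
      + (3 * g (Suc m) - g (Suc (Suc m)) - g m) * of_nat (fib (2 * (Suc n - Suc m)))"
    by simp
  then show ?case
    by (simp only: Suc.IH[OF Suc_leD[OF Suc.prems]] idx f) (simp only: algebra_simps)
qed

theorem mainTheorem7:
  fixes n :: nat and y :: complex
  assumes "n \<ge> 1"
  shows "laguerre1 (n - 1) y - of_nat (fib (2 * n)) =
    - (\<Sum>k=1..n - 1. (y / of_nat k + 1) * laguerre1 (k - 1) y * of_nat (fib (2 * (n - k))))"
proof -
  \<comment> \<open>The value \<open>g 0 = 0\<close> makes the recurrence hold at
    \<open>k = 1\<close> as well and removes one boundary term.\<close>
  define g where "g k = (if k = 0 then 0 else laguerre1 (k - 1) y)" for k
  obtain N where n: "n = Suc N"
    using assms by (cases n) auto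
  have rec: "(y / of_nat k + 1) * laguerre1 (k - 1) y = 3 * g k - g (Suc k) - g (k - 1)"
    if "k \<ge> 1" for k
  \<comment> \<open>The Laguerre recurrence starts at \<open>k = 2\<close>; for \<open>k = 1\<close>
    both sides equal y + 1.\<close>
  proof (cases "k = 1")
    case True
    then show ?thesis by (simp add: g_def laguerre1_def)
  next
    case False
    with that have "k \<ge> 2"
      by simp
    then obtain m where k: "k = m + 2"
      using le_Suc_ex by (metis add.commute)
    have "(y / of_nat k) * laguerre1 (k - 1) y =
        - (laguerre1 (Suc (Suc m)) y - 2 * laguerre1 (Suc m) y + laguerre1 m y)"
      unfolding laguerre1_recurrence k by (simp del: of_nat_add)
    then show ?thesis
      unfolding distrib_right by (simp add: g_def k del: of_nat_add)
  qed
  have "(\<Sum>k=1..n - 1. (y / of_nat k + 1) * laguerre1 (k - 1) y * of_nat (fib (2 * (n - k)))) =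
      (\<Sum>k=1..N. (3 * g k - g (Suc k) - g (k - 1)) * of_nat (fib (2 * (Suc N - k))))"
    unfolding n by (intro sum.cong) (simp_all only: rec diff_Suc_1 atLeastAtMost_iff)
  \<comment> \<open>At the upper end the Fibonacci factors are \<open>fib 2 = 1\<close> and
    \<open>fib 0 = 0\<close>, so only \<open>g n\<close> survives; at the lower end
    \<open>g 1 = 1\<close> leaves \<open>fib (2 * n)\<close>.\<close>
  also have "\<dots> = of_nat (fib (2 * n)) - laguerre1 (n - 1) y"
    unfolding sum_second_difference_mult_fib[OF order_refl]
    by (simp add: n g_def laguerre1_def[of 0])
  finally show ?thesis by simp
qed

end
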